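(* Let $\mathbf p\in\mathcal P$ and let $(\mathbf x^{(k)},\mathbf y^{(k)})_k$ be the iterates generated by the alternate projections method on $\mathcal X$ and $\mathcal Y_{\mathbf p}$. Then one of the following holds. (i) If $\mathcal X\cap\mathcal Y_{\mathbf p}\neq\emptyset$, then $\mathbf x^{(k)}$ and $\mathbf y^{(k)}$ both converge, as $k\to\infty$, to a common point $\mathbf x^\infty\in\mathcal X\cap\mathcal Y_{\mathbf p}$. (ii) If $\mathcal X\cap\mathcal Y_{\mathbf p}=\emptyset$, then $\mathbf x^{(k)}\to\mathbf x^\infty\in\mathcal X$ and $\mathbf y^{(k)}\to\mathbf y^\infty\in\mathcal Y_{\mathbf p}$. Moreover, with the sets $$\mathcal T:=\{t\in[T]\;:\;\exists n\in[N],\ y^\infty_{n,t}>\overline x_{n,t}\},\qquad \mathcal N:=\Big\{n\in[N]\;:\;E_n-\sum_{t\notin\mathcal T}\underline x_{n,t}-\sum_{t\in\mathcal T}\overline x_{n,t}<0\Big\},$$ the following inequality holds (that is, the Hoffman inequality associated with $(\mathcal T,\mathcal N)$ is violated by $\mathbf p$): $$\sum_{n\in\mathcal N}E_n-\sum_{t\in\mathcal T}p_t+\sum_{t\in\mathcal T,\,n\notin\mathcal N}\overline x_{n,t}-\sum_{t\notin\mathcal T,\,n\in\mathcal N}\underline x_{n,t}<0 .$$ Furthermore this inequality can be rewritten in terms of $\mathbf x^\infty$ as $$A_{\mathcal T}(\mathbf x^\infty)<\sum_{t\in\mathcal T}p_t,\qquad A_{\mathcal T}(\mathbf x^\infty):=\sum_{t\in\mathcal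 T}\sum_{n\in[N]}x^\infty_{n,t},$$ i.e. $\sum_{n\in\mathcal N}E_n+\sum_{t\in\mathcal T,n\notin\mathcal N}\overline x_{n,t}-\sum_{t\notin\mathcal T,n\in\mathcal N}\underline x_{n,t}=A_{\mathcal T}(\mathbf x^\infty)$.
   Context: Let $N,T\ge 1$ be integers, $[N]=\{1,\dots,N\}$, $[T]=\{1,\dots,T\}$. For each $n\in[N]$ there are given $E_n>0$ and vectors $\underline{\mathbf x}_n,\overline{\mathbf x}_n\in\mathbb R^T$ such that $\mathcal X_n=\{\mathbf x_n\in\mathbb R^T:\ \sum_{t\in[T]}x_{n,t}=E_n,\ \underline x_{n,t}\le x_{n,t}\le\overline x_{n,t}\ \forall t\}$ is nonempty. Put $\mathcal X=\prod_{n\in[N]}\mathcal X_n\subset\mathbb R^{NT}$. $\mathcal P\subset\mathbb R^T$ is a set all of whose elements $\mathbf p$ satisfy the aggregate conditions $\sum_{t}p_t=\sum_n E_n$ and $\sum_n\underline x_{n,t}\le p_t\le\sum_n\overline x_{n,t}$ for all $t\in[T]$. For $\mathbf p\in\mathcal P$, $\mathcal Y_{\mathbf p}=\{\mathbf x\in\mathbb R^{NT}:\ \sum_{n\in[N]}x_{n,t}=p_t\ \forall t\in[T]\}$. Alternate projections method (APM): starting from any $\mathbf y^{(0)}\in\mathbb R^{NT}$, set $\mathbf x^{(k+1)}=P_{\mathcal X}(\mathbf y^{(k)})$ and $\mathbf y^{(k+1)}=P_{\mathcal Y_{\mathbf p}}(\mathbf x^{(k+1)})$ for $k\ge0$ (infinitely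 many iterations), where $P_C$ is the Euclidean projection onto the closed convex set $C$. For $\mathcal T\subset[T]$, $\mathcal N\subset[N]$, the Hoffman inequality associated with $(\mathcal T,\mathcal N)$ is $\sum_{t\in\mathcal T}p_t-\sum_{n\in\mathcal N}E_n+\sum_{t\notin\mathcal T,n\in\mathcal N}\underline x_{n,t}\le\sum_{t\in\mathcal T,n\notin\mathcal N}\overline x_{n,t}$. *)

theory Defs
  imports "HOL-Analysis.Analysis"
begin

text \<open>
  Agents are indexed by a finite type 'n and time periods by a finite type 't (both automatically
  nonempty).  A profile \<open>x :: real^'t^'n\<close> has entries \<open>x $ n $ t\<close>; its norm is the
  Euclidean norm of the flattened vector with N T entries, so \<open>closest_point\<close> is the
  Euclidean projection.
\<close>

definition agent_set :: "real \<Rightarrow> real^'t \<Rightarrow> real^'t \<Rightarrow> (real^'t) set" where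
  "agent_set e lo up =
     {x. (\<Sum>t\<in>UNIV. x $ t) = e \<and> (\<forall>t. lo $ t \<le> x $ t \<and> x $ t \<le> up $ t)}"

definition profile_set :: "('n \<Rightarrow> real) \<Rightarrow> real^'t^'n \<Rightarrow> real^'t^'n \<Rightarrow> (real^'t^'n) set" where
  "profile_set E lo up = {x. \<forall>n. x $ n \<in> agent_set (E n) (lo $ n) (up $ n)}"

definition aggregate_ok ::
    "('n::finite \<Rightarrow> real) \<Rightarrow> real^'t^'n \<Rightarrow> real^'t^'n \<Rightarrow> real^'t \<Rightarrow> bool" where
  "aggregate_ok E lo up p \<longleftrightarrow>
     (\<Sum>t\<in>UNIV. p $ t) = (\<Sum>n\<in>UNIV. E n) \<and>
     (\<forall>t. (\<Sum>n\<in>UNIV. lo $ n $ t) \<le> p $ t \<and> p $ t \<le> (\<Sum>n\<in>UNIV. up $ n $ t))"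

definition disagg_set :: "real^'t \<Rightarrow> (real^'t^'n) set" where
  "disagg_set p = {x. \<forall>t. (\<Sum>n\<in>UNIV. x $ n $ t) = p $ t}"

text \<open>
  The method starts from an arbitrary \<open>y 0\<close>; the sequence \<open>x\<close> is generated only from
  index 1 on, and \<open>x 0\<close> is an unused dummy.
\<close>

definition apm_iterates ::
    "'a::euclidean_space set \<Rightarrow> 'a set \<Rightarrow> (nat \<Rightarrow> 'a) \<Rightarrow> (nat \<Rightarrow> 'a) \<Rightarrow> bool" where
  "apm_iterates X Y x y \<longleftrightarrow>
     (\<forall>k. x (Suc k) = closest_point X (y k) \<and> y (Suc k) = closest_point Y (x (Suc k)))"

definition hoffman_ineq ::
    "('n::finite \<Rightarrow> real) \<Rightarrow> real^'t^'n \<Rightarrow> real^'t^'n \<Rightarrow> real^'t \<Rightarrow> 't set \<Rightarrow> 'n set \<Rightarrow> bool" where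
  "hoffman_ineq E lo up p T N \<longleftrightarrow>
     (\<Sum>t\<in>T. p $ t) - (\<Sum>n\<in>N. E n) + (\<Sum>t\<in>-T. \<Sum>n\<in>N. lo $ n $ t)
       \<le> (\<Sum>t\<in>T. \<Sum>n\<in>-N. up $ n $ t)"

definition cut_times :: "real^'t^'n \<Rightarrow> real^'t^'n \<Rightarrow> 't set" where
  "cut_times up y = {t. \<exists>n. y $ n $ t > up $ n $ t}"

definition cut_agents ::
    "('n \<Rightarrow> real) \<Rightarrow> real^'t^'n \<Rightarrow> real^'t^'n \<Rightarrow> 't set \<Rightarrow> 'n set" where
  "cut_agents E lo up T =
     {n. E n - (\<Sum>t\<in>-T. lo $ n $ t) - (\<Sum>t\<in>T. up $ n $ t) < 0}"

definition agg_load :: "'t set \<Rightarrow> real^'t^'n \<Rightarrow> real" where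
  "agg_load T x = (\<Sum>t\<in>T. \<Sum>n\<in>UNIV. x $ n $ t)"

end

theory Submission
  imports Defs
begin

text \<open>
  The distance between consecutive iterates decreases, so by continuity of the projections every
  cluster point of the compact sequence \<open>x\<close> is fixed under \<open>P\<^sub>X \<circ> P\<^sub>Y\<close>; since both projections are
  nonexpansive, the distance to that fixed point decreases along the whole sequence, which therefore
  converges.

  At the limit, \<open>y\<^sub>n\<^sub>t = x\<^sub>n\<^sub>t + d\<^sub>t\<close> with a vector \<open>d\<close> that does not depend on the agent and
  has \<open>\<Sum>\<^sub>t d\<^sub>t = 0\<close>, and each \<open>x\<^sub>n\<close> maximises \<open>d \<bullet> z\<close> over its agent set.  The
  aggregate conditions force the cut to be exactly \<open>{t. d\<^sub>t > 0}\<close>, and optimality then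
  saturates \<open>x\<close> at the upper or the lower bounds across that cut.
\<close>

section \<open>Alternating projections\<close>

text \<open>Projection makes the angles of the triangle \<open>x\<close>, \<open>y\<close>,
  \<open>z\<close> at \<open>x\<close> and at \<open>y\<close> at least right angles; adding the two
  inequalities leaves the squared distance of \<open>x\<close> and \<open>y\<close> at most
  0.\<close>

lemma closest_point_mutual_eq:
  fixes x y :: "'a::euclidean_space"
  assumes "convex X" "closed X" "convex Y" "closed Y"
    and x: "x = closest_point X y" and y: "y = closest_point Y x"
    and "z \<in> X" "z \<in> Y"
  shows "x = y"
proof -
  have "(y - x) \<bullet> (z - x) \<le> 0"
    using closest_point_dot[OF \<open>convex X\<close> \<open>closed X\<close> \<open>z \<in> X\<close>, of y] x by simp
  moreover have "(x - y) \<bullet> (z - y) \<le> 0"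
    using closest_point_dot[OF \<open>convex Y\<close> \<open>closed Y\<close> \<open>z \<in> Y\<close>, of x] y by simp
  moreover have "(y - x) \<bullet> (z - x) + (x - y) \<bullet> (z - y) = (y - x) \<bullet> (y - x)"
    by (simp add: inner_diff inner_commute)
  ultimately have "(y - x) \<bullet> (y - x) \<le> 0" by linarith
  then have "y - x = 0" by (metis inner_eq_zero_iff inner_ge_zero order_antisym)
  then show ?thesis by simp
qed

lemma apm_converges:
  fixes X Y :: "'a::euclidean_space set"
  assumes X: "compact X" "convex X" "X \<noteq> {}"
    and Y: "closed Y" "convex Y" "Y \<noteq> {}"
    and it: "apm_iterates X Y x y"
  obtains xinf yinf where "x \<longlonglongrightarrow> xinf" "y \<longlonglongrightarrow> yinf"
    "xinf = closest_point X yinf" "yinf = closest_point Y xinf"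
proof -
  have cX: "closed X" using X compact_imp_closed by blast
  define PX where "PX = closest_point X"
  define PY where "PY = closest_point Y"
  \<comment> \<open>\<open>x 0\<close> is arbitrary and may lie outside \<open>X\<close>; the
    shifted sequence stays in \<open>X\<close>.\<close>
  define g where "g k = x (Suc k)" for k
  have gS: "g (Suc k) = PX (PY (g k))" and yS: "y (Suc k) = PY (g k)" for k
    using it by (auto simp: apm_iterates_def g_def PX_def PY_def)
  have gX: "g k \<in> X" for k
    using it closest_point_in_set[OF cX \<open>X \<noteq> {}\<close>] by (auto simp: apm_iterates_def g_def)
  have PYin: "PY a \<in> Y" for a
    unfolding PY_def by (rule closest_point_in_set[OF Y(1,3)])
  have PXin: "PX a \<in> X" for a
    unfolding PX_def by (rule closest_point_in_set[OF cX X(3)])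
  have lX: "dist (PX a) (PX b) \<le> dist a b" for a b
    unfolding PX_def by (rule closest_point_lipschitz[OF X(2) cX X(3)])
  have lY: "dist (PY a) (PY b) \<le> dist a b" for a b
    unfolding PY_def by (rule closest_point_lipschitz[OF Y(2) Y(1) Y(3)])
  have tX: "(\<lambda>k. PX (f k)) \<longlonglongrightarrow> PX l" if "f \<longlonglongrightarrow> l" for f :: "nat \<Rightarrow> 'a" and l
    using continuous_at_closest_point[OF X(2) cX X(3)] that
    unfolding PX_def by (rule isCont_tendsto_compose)
  have tY: "(\<lambda>k. PY (f k)) \<longlonglongrightarrow> PY l" if "f \<longlonglongrightarrow> l" for f :: "nat \<Rightarrow> 'a" and l
    using continuous_at_closest_point[OF Y(2) Y(1) Y(3)] that
    unfolding PY_def by (rule isCont_tendsto_compose)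
  define \<delta> where "\<delta> k = dist (g k) (PY (g k))" for k
  \<comment> \<open>In each half step the preceding point of the target set competes with the new
    projection, so the gap cannot grow.\<close>
  have step1: "dist (PY (g k)) (g (Suc k)) \<le> \<delta> k" for k
    using closest_point_le[OF cX gX, of "PY (g k)" k]
    by (simp add: \<delta>_def gS PX_def dist_commute)
  have step2: "\<delta> (Suc k) \<le> dist (PY (g k)) (g (Suc k))" for k
    using closest_point_le[OF Y(1) PYin, of "g (Suc k)" "g k"]
    by (simp add: \<delta>_def PY_def dist_commute)
  have "decseq \<delta>"
    using step1 step2 by (intro decseq_SucI) (meson order_trans)
  moreover have "\<And>k. 0 \<le> \<delta> k" by (simp add: \<delta>_def)
  ultimately obtain D where D: "\<delta> \<longlonglongrightarrow> D"
    using decseq_convergent[of \<delta> 0] by metis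
  have D': "(\<lambda>k. dist (PY (g k)) (g (Suc k))) \<longlonglongrightarrow> D"
  proof (rule tendsto_sandwich)
    show "(\<lambda>k. \<delta> (Suc k)) \<longlonglongrightarrow> D" using D by (rule LIMSEQ_Suc)
  qed (use D step1 step2 in auto)
  obtain l r where l: "l \<in> X" and r: "strict_mono r" "(g \<circ> r) \<longlonglongrightarrow> l"
    using X(1) gX unfolding compact_def by metis
  have gr: "(\<lambda>k. g (r k)) \<longlonglongrightarrow> l" using r(2) by (simp add: o_def)
  have "(\<lambda>k. \<delta> (r k)) \<longlonglongrightarrow> dist l (PY l)"
    unfolding \<delta>_def by (intro tendsto_dist tY gr)
  with LIMSEQ_subseq_LIMSEQ[OF D r(1)] have e1: "dist l (PY l) = D"
    using LIMSEQ_unique by (fastforce simp: o_def)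
  have "(\<lambda>k. dist (PY (g (r k))) (g (Suc (r k)))) \<longlonglongrightarrow> dist (PY l) (PX (PY l))"
    unfolding gS by (intro tendsto_dist tX tY gr)
  with LIMSEQ_subseq_LIMSEQ[OF D' r(1)] have e2: "dist (PY l) (PX (PY l)) = D"
    using LIMSEQ_unique by (fastforce simp: o_def)
  \<comment> \<open>Both gaps tend to the same \<open>D\<close>, so \<open>l\<close> is as near to
    \<open>PY l\<close> as the projection is; nearest points are unique.\<close>
  have fix_l: "l = PX (PY l)"
    unfolding PX_def
  proof (rule closest_point_unique[OF X(2) cX l])
    show "\<forall>z\<in>X. dist (PY l) l \<le> dist (PY l) z"
      using e1 e2 closest_point_le[OF cX] by (metis PX_def dist_commute)
  qed
  have dec: "dist (g (Suc k)) l \<le> dist (g k) l" for k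
    using lX[of "PY (g k)" "PY l"] lY[of "g k" l] fix_l gS[of k] by (metis order_trans)
  have mono: "dist (g m) l \<le> dist (g k) l" if "k \<le> m" for k m
    using lift_Suc_antimono_le[of "\<lambda>k. dist (g k) l", OF dec that] .
  have glim: "g \<longlonglongrightarrow> l"
  \<comment> \<open>One term of the subsequence close to \<open>l\<close> suffices, since later
    distances to \<open>l\<close> never increase.\<close>
  proof (rule metric_LIMSEQ_I)
    fix e :: real assume "0 < e"
    then obtain k where "dist (g (r k)) l < e"
      using metric_LIMSEQ_D[OF gr] by blast
    then show "\<exists>no. \<forall>n\<ge>no. dist (g n) l < e"
      using mono by (meson le_less_trans)
  qed
  show ?thesis
  proof (rule that)
    show "x \<longlonglongrightarrow> l" using glim unfolding g_def by (rule LIMSEQ_imp_Suc)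
    show "y \<longlonglongrightarrow> PY l" by (rule LIMSEQ_imp_Suc) (simp add: yS tY[OF glim])
    show "l = closest_point X (PY l)" using fix_l by (simp add: PX_def)
    show "PY l = closest_point Y l" by (simp add: PY_def)
  qed
qed

section \<open>The constraint sets\<close>

lemma convex_agent_set: "convex (agent_set e lo up)"
proof (rule convexI)
  fix x y and u v :: real
  assume x: "x \<in> agent_set e lo up" and y: "y \<in> agent_set e lo up"
    and uv: "0 \<le> u" "0 \<le> v" "u + v = 1"
  have "lo $ t \<le> u * x $ t + v * y $ t \<and> u * x $ t + v * y $ t \<le> up $ t" for t
    using x y uv convex_bound_le[of "x $ t" "up $ t" "y $ t" u v]
      convex_bound_le[of "- x $ t" "- lo $ t" "- y $ t" u v]
    by (auto simp: agent_set_def)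
  moreover have "u * e + v * e = e" using uv by (simp flip: distrib_right)
  ultimately show "u *\<^sub>R x + v *\<^sub>R y \<in> agent_set e lo up"
    using x y by (simp add: agent_set_def sum.distrib flip: sum_distrib_left)
qed

lemma convex_profile_set: "convex (profile_set E lo up)"
proof (rule convexI)
  fix x y and u v :: real
  assume "x \<in> profile_set E lo up" "y \<in> profile_set E lo up" "0 \<le> u" "0 \<le> v" "u + v = 1"
  then have "u *\<^sub>R x $ n + v *\<^sub>R y $ n \<in> agent_set (E n) (lo $ n) (up $ n)" for n
    by (intro convexD[OF convex_agent_set]) (auto simp: profile_set_def)
  then show "u *\<^sub>R x + v *\<^sub>R y \<in> profile_set E lo up"
    by (simp add: profile_set_def)
qed

lemma closed_profile_set:
  fixes lo up :: "real^'t::finite^'n::finite"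
  shows "closed (profile_set E lo up)"
  unfolding profile_set_def agent_set_def mem_Collect_eq
  by (intro closed_Collect_all closed_Collect_conj closed_Collect_eq closed_Collect_le
      continuous_intros)

lemma bounded_profile_set:
  fixes lo up :: "real^'t::finite^'n::finite"
  shows "bounded (profile_set E lo up)"
proof -
  have "norm x \<le> (\<Sum>n\<in>UNIV. \<Sum>t\<in>UNIV. \<bar>lo $ n $ t\<bar> + \<bar>up $ n $ t\<bar>)"
    if x: "x \<in> profile_set E lo up" for x
  proof -
    have "norm x \<le> (\<Sum>n\<in>UNIV. norm (x $ n))"
      unfolding norm_vec_def by (rule L2_set_le_sum) simp
    also have "\<dots> \<le> (\<Sum>n\<in>UNIV. \<Sum>t\<in>UNIV. \<bar>x $ n $ t\<bar>)"
      by (intro sum_mono norm_le_l1_cart)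
    also have "\<dots> \<le> (\<Sum>n\<in>UNIV. \<Sum>t\<in>UNIV. \<bar>lo $ n $ t\<bar> + \<bar>up $ n $ t\<bar>)"
    proof (intro sum_mono)
      fix n t
      have "lo $ n $ t \<le> x $ n $ t" "x $ n $ t \<le> up $ n $ t"
        using x by (auto simp: profile_set_def agent_set_def)
      then show "\<bar>x $ n $ t\<bar> \<le> \<bar>lo $ n $ t\<bar> + \<bar>up $ n $ t\<bar>" by linarith
    qed
    finally show ?thesis .
  qed
  then show ?thesis unfolding bounded_iff by blast
qed

lemma compact_profile_set:
  fixes lo up :: "real^'t::finite^'n::finite"
  shows "compact (profile_set E lo up)"
  by (simp add: compact_eq_bounded_closed bounded_profile_set closed_profile_set)

lemma profile_set_nonempty:
  assumes "\<And>n. agent_set (E n) (lo $ n) (up $ n) \<noteq> {}"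
  shows "profile_set E lo up \<noteq> {}"
proof -
  have "\<forall>n. \<exists>v. v \<in> agent_set (E n) (lo $ n) (up $ n)"
    using assms by blast
  then obtain f where "\<And>n. f n \<in> agent_set (E n) (lo $ n) (up $ n)"
    by metis
  then have "(\<chi> n. f n) \<in> profile_set E lo up" by (simp add: profile_set_def)
  then show ?thesis by blast
qed

lemma convex_disagg_set: "convex (disagg_set p)"
  unfolding disagg_set_def convex_def
  by (auto simp: sum.distrib sum_distrib_left[symmetric] distrib_right[symmetric])

lemma closed_disagg_set:
  fixes p :: "real^'t::finite"
  shows "closed (disagg_set p :: (real^'t^'n::finite) set)"
  unfolding disagg_set_def
  by (intro closed_Collect_all closed_Collect_eq continuous_intros)

text \<open>The correction that projection onto \<open>disagg_set p\<close> gives to every agent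
  alike; at the limit profile it is the vector \<open>d\<close>.\<close>

definition spread :: "real^'t \<Rightarrow> real^'t^'n::finite \<Rightarrow> real^'t" where
  "spread p x = (\<chi> t. (p $ t - (\<Sum>n\<in>UNIV. x $ n $ t)) / real CARD('n))"

lemma sum_spread:
  fixes x :: "real^'t^'n::finite"
  shows "real CARD('n) * spread p x $ t = p $ t - (\<Sum>n\<in>UNIV. x $ n $ t)"
  by (simp add: spread_def)

lemma add_spread_in_disagg_set: "(\<chi> n. x $ n + spread p x) \<in> disagg_set p"
  by (simp add: disagg_set_def sum.distrib sum_spread)

text \<open>The displacement is the same for all agents, hence orthogonal to every difference of two
  points of the affine set, whose sum over agents vanishes in each period.\<close>

lemma closest_point_disagg_set:
  fixes x :: "real^'t::finite^'n::finite"
  shows "closest_point (disagg_set p) x = (\<chi> n. x $ n + spread p x)"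
    (is "?y = ?z")
proof -
  have z: "?z \<in> disagg_set p" by (rule add_spread_in_disagg_set)
  then have y: "?y \<in> disagg_set p"
    by (intro closest_point_in_set closed_disagg_set) auto
  have le: "(x - ?y) \<bullet> (?z - ?y) \<le> 0"
    by (rule closest_point_dot[OF convex_disagg_set closed_disagg_set z])
  have "(x - ?z) \<bullet> (?z - ?y) = (\<Sum>n\<in>UNIV. \<Sum>t\<in>UNIV. - spread p x $ t * (?z - ?y) $ n $ t)"
    by (simp add: inner_vec_def)
  also have "\<dots> = (\<Sum>t\<in>UNIV. - spread p x $ t * (\<Sum>n\<in>UNIV. (?z - ?y) $ n $ t))"
    by (subst sum.swap) (simp only: sum_distrib_left)
  also have "\<dots> = 0"
    using y z by (intro sum.neutral) (simp add: disagg_set_def sum_subtractf)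
  finally have "(x - ?z) \<bullet> (?z - ?y) = 0" .
  then have "(?z - ?y) \<bullet> (?z - ?y) \<le> 0"
    using le by (simp add: inner_diff inner_commute)
  then have "?z - ?y = 0" by (metis inner_eq_zero_iff inner_ge_zero order_antisym)
  then show ?thesis by simp
qed

text \<open>First-order optimality: shifting load from period \<open>s\<close> to period \<open>t\<close> must not pay off.\<close>

lemma closest_point_profile_set_exchange:
  fixes x :: "real^'t::finite^'n::finite"
  assumes x: "x = closest_point (profile_set E lo up) y" and xX: "x \<in> profile_set E lo up"
    and t: "x $ n $ t < up $ n $ t" and s: "lo $ n $ s < x $ n $ s"
  shows "(y - x) $ n $ t \<le> (y - x) $ n $ s"
proof (cases "t = s")
  case False
  \<comment> \<open>The largest amount agent \<open>n\<close> can move from \<open>s\<close> to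
    \<open>t\<close> within its bounds; \<open>w\<close> below is this move, which keeps the energy
    unchanged.\<close>
  define e where "e = min (up $ n $ t - x $ n $ t) (x $ n $ s - lo $ n $ s)"
  have e: "0 < e" "e \<le> up $ n $ t - x $ n $ t" "e \<le> x $ n $ s - lo $ n $ s"
    using t s by (auto simp: e_def)
  define w where "w = axis n (axis t e - axis s e)"
  have wn: "w $ n $ u = (if u = t then e else if u = s then - e else 0)" for u
    using False by (auto simp: w_def axis_def)
  have wm: "w $ m $ u = 0" if "m \<noteq> n" for m u
    using that by (simp add: w_def axis_def)
  have "x + w \<in> profile_set E lo up"
    unfolding profile_set_def agent_set_def mem_Collect_eq
  proof (intro allI conjI)
    fix m u
    have b: "lo $ m $ u \<le> x $ m $ u" "x $ m $ u \<le> up $ m $ u"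
      and E: "(\<Sum>t\<in>UNIV. x $ m $ t) = E m"
      using xX by (auto simp: profile_set_def agent_set_def)
    have "(\<Sum>u\<in>UNIV. w $ m $ u) = 0"
    proof (cases "m = n")
      case True
      have "(\<Sum>u\<in>UNIV. w $ n $ u) = (\<Sum>u\<in>UNIV. (if u = t then e else 0) - (if u = s then e else 0))"
        using False by (intro sum.cong) (auto simp: wn)
      then show ?thesis using True by (simp add: sum_subtractf)
    qed (simp add: wm)
    then show "(\<Sum>u\<in>UNIV. (x + w) $ m $ u) = E m" by (simp add: sum.distrib E)
    show "lo $ m $ u \<le> (x + w) $ m $ u" "(x + w) $ m $ u \<le> up $ m $ u"
      using b e False by (cases "m = n"; auto simp: wn wm)+
  qed
  then have "(y - x) \<bullet> (x + w - x) \<le> 0"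
    using closest_point_dot[OF convex_profile_set closed_profile_set, of "x + w" E lo up y] x
    by simp
  then have "e * ((y - x) $ n $ t - (y - x) $ n $ s) \<le> 0"
    by (simp add: w_def inner_axis inner_diff_right algebra_simps)
  then show ?thesis using e(1) by (simp add: mult_le_0_iff)
qed simp

section \<open>The violated Hoffman inequality\<close>

locale apm_limit =
  fixes E :: "'n::finite \<Rightarrow> real"
    and lo up x y :: "real^'t::finite^'n"
    and p :: "real^'t"
  assumes agg: "aggregate_ok E lo up p"
    and xX: "x \<in> profile_set E lo up"
    and xproj: "x = closest_point (profile_set E lo up) y"
    and yproj: "y = closest_point (disagg_set p) x"
begin

abbreviation d where "d \<equiv> spread p x"

abbreviation T where "T \<equiv> cut_times up y"

abbreviation N where "N \<equiv> cut_agents E lo up T"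

lemma y_eq: "y $ n $ t = x $ n $ t + d $ t"
  by (subst yproj) (simp add: closest_point_disagg_set)

lemma bounds: "lo $ n $ t \<le> x $ n $ t" "x $ n $ t \<le> up $ n $ t"
  and energy: "(\<Sum>t\<in>UNIV. x $ n $ t) = E n"
  using xX by (auto simp: profile_set_def agent_set_def)

text \<open>Since \<open>y - x\<close> equals \<open>d\<close> for every agent, an agent with slack
  at both periods would gain by moving load from \<open>s\<close> to \<open>t\<close>.\<close>

lemma exchange:
  assumes "d $ s < d $ t"
  shows "x $ n $ t = up $ n $ t \<or> x $ n $ s = lo $ n $ s"
  using closest_point_profile_set_exchange[OF xproj xX, of n t s] assms bounds[of n]
  by (force simp: y_eq order_less_le)

text \<open>The profile \<open>x\<close> and the target \<open>p\<close> have the same total, namely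
  the total energy.\<close>

lemma sum_d: "(\<Sum>t\<in>UNIV. d $ t) = 0"
proof -
  have "real CARD('n) * (\<Sum>t\<in>UNIV. d $ t) = (\<Sum>t\<in>UNIV. p $ t) - (\<Sum>t\<in>UNIV. \<Sum>n\<in>UNIV. x $ n $ t)"
    by (simp add: sum_distrib_left sum_spread sum_subtractf)
  also have "\<dots> = 0"
    using agg by (subst sum.swap) (simp add: energy aggregate_ok_def)
  finally show ?thesis by simp
qed

text \<open>
  If some \<open>t\<close> with \<open>d\<^sub>t > 0\<close> were not in the cut, no agent would be saturated at \<open>t\<close>, so all
  agents would be at their lower bounds wherever \<open>d\<close> is smaller; the aggregate condition then makes
  \<open>d\<close> nonnegative everywhere.
\<close>

lemma cut_times_eq: "T = {t. 0 < d $ t}"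
proof (intro equalityI subsetI)
  fix t assume "t \<in> T"
  then obtain n where "up $ n $ t < x $ n $ t + d $ t"
    by (auto simp: cut_times_def y_eq)
  then show "t \<in> {t. 0 < d $ t}" using bounds(2)[of n t] by simp
next
  fix t assume "t \<in> {t. 0 < d $ t}"
  then have dt: "0 < d $ t" by simp
  show "t \<in> T"
  proof (rule ccontr)
    assume "t \<notin> T"
    \<comment> \<open>Outside the cut even \<open>x + d\<close> respects the upper bound, and
      \<open>d\<close> is positive at \<open>t\<close>.\<close>
    then have *: "x $ n $ t < up $ n $ t" for n
      using dt by (force simp: cut_times_def y_eq not_less dest: spec[of _ n])
    have "0 \<le> d $ s" for s
    proof (cases "d $ s < d $ t")
      case True
      then have "x $ n $ s = lo $ n $ s" for n using exchange[OF True, of n] *[of n] by auto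
      then have "0 \<le> real CARD('n) * d $ s"
        using agg by (simp add: sum_spread aggregate_ok_def)
      then show ?thesis by (simp add: zero_le_mult_iff)
    qed (use dt in linarith)
    then have "\<forall>s\<in>UNIV. d $ s = 0"
      using sum_d by (subst (asm) sum_nonneg_eq_0_iff) auto
    then show False using dt by simp
  qed
qed

text \<open>\<open>exchange\<close> applies to every pair across the cut, where \<open>d\<close>
  changes sign; a single unsaturated \<open>t\<close> therefore forces all \<open>s\<close> outside
  to the lower bound.\<close>

lemma saturation: "(\<forall>t\<in>T. x $ n $ t = up $ n $ t) \<or> (\<forall>s\<in>-T. x $ n $ s = lo $ n $ s)"
proof -
  have "x $ n $ t = up $ n $ t \<or> x $ n $ s = lo $ n $ s" if "t \<in> T" "s \<in> - T" for t s
    using that by (intro exchange) (simp add: cut_times_eq)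
  then show ?thesis by blast
qed

lemma energy_split: "E n = (\<Sum>t\<in>T. x $ n $ t) + (\<Sum>t\<in>-T. x $ n $ t)"
  unfolding energy[of n, symmetric]
  by (subst sum.union_disjoint[symmetric]) (auto simp: Compl_partition)

text \<open>An agent in \<open>N\<close> has too little energy to fill the cut to its upper bounds,
  so the other alternative of \<open>saturation\<close> holds.\<close>

lemma load_cut_agents:
  assumes "n \<in> N"
  shows "(\<Sum>t\<in>T. x $ n $ t) = E n - (\<Sum>t\<in>-T. lo $ n $ t)"
proof -
  have "(\<Sum>t\<in>-T. lo $ n $ t) \<le> (\<Sum>t\<in>-T. x $ n $ t)"
    by (intro sum_mono bounds)
  then have "(\<Sum>t\<in>T. x $ n $ t) \<noteq> (\<Sum>t\<in>T. up $ n $ t)"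
    using assms energy_split[of n] by (simp add: cut_agents_def)
  then have "\<not> (\<forall>t\<in>T. x $ n $ t = up $ n $ t)"
    by (metis (no_types, lifting) sum.cong)
  then have "(\<Sum>t\<in>-T. x $ n $ t) = (\<Sum>t\<in>-T. lo $ n $ t)"
    using saturation[of n] by (intro sum.cong) auto
  then show ?thesis using energy_split[of n] by simp
qed

text \<open>An agent outside \<open>N\<close> that is at its lower bounds off the cut has enough
  energy left to fill the cut completely.\<close>

lemma load_non_cut_agents:
  assumes "n \<notin> N"
  shows "(\<Sum>t\<in>T. x $ n $ t) = (\<Sum>t\<in>T. up $ n $ t)"
  using saturation[of n]
proof
  assume "\<forall>s\<in>-T. x $ n $ s = lo $ n $ s"
  then have "(\<Sum>t\<in>T. up $ n $ t) \<le> (\<Sum>t\<in>T. x $ n $ t)"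
    using assms energy_split[of n] by (simp add: cut_agents_def)
  moreover have "(\<Sum>t\<in>T. x $ n $ t) \<le> (\<Sum>t\<in>T. up $ n $ t)"
    by (intro sum_mono bounds)
  ultimately show ?thesis by linarith
qed simp

text \<open>The load of each agent over the cut is known exactly, by one formula in \<open>N\<close>
  and another outside; the sum over agents gives the identity.\<close>

lemma agg_load_eq:
  "(\<Sum>n\<in>N. E n) + (\<Sum>t\<in>T. \<Sum>n\<in>-N. up $ n $ t) - (\<Sum>t\<in>-T. \<Sum>n\<in>N. lo $ n $ t) = agg_load T x"
proof -
  have "agg_load T x = (\<Sum>n\<in>UNIV. \<Sum>t\<in>T. x $ n $ t)"
    unfolding agg_load_def by (rule sum.swap)
  also have "\<dots> = (\<Sum>n\<in>N. \<Sum>t\<in>T. x $ n $ t) + (\<Sum>n\<in>-N. \<Sum>t\<in>T. x $ n $ t)"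
    by (subst sum.union_disjoint[symmetric]) (auto simp: Compl_partition)
  also have "\<dots> = (\<Sum>n\<in>N. E n - (\<Sum>t\<in>-T. lo $ n $ t)) + (\<Sum>n\<in>-N. \<Sum>t\<in>T. up $ n $ t)"
    by (simp add: load_cut_agents load_non_cut_agents)
  also have "\<dots> = (\<Sum>n\<in>N. E n) - (\<Sum>t\<in>-T. \<Sum>n\<in>N. lo $ n $ t) + (\<Sum>t\<in>T. \<Sum>n\<in>-N. up $ n $ t)"
    by (simp only: sum_subtractf sum.swap[of _ N "-T"] sum.swap[of _ "-N" T])
  finally show ?thesis by simp
qed

text \<open>The shortfall of \<open>x\<close> over the cut is \<open>CARD('n)\<close> times the sum
  of the positive entries of \<open>d\<close>.\<close>

lemma agg_load_less:
  assumes "x \<noteq> y"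
  shows "agg_load T x < (\<Sum>t\<in>T. p $ t)"
proof -
  have "T \<noteq> {}"
  proof
    \<comment> \<open>Without positive entries, the zero sum would make \<open>d\<close> vanish and
      the two limits coincide.\<close>
    assume "T = {}"
    then have "\<And>t. d $ t \<le> 0" by (auto simp: cut_times_eq not_less)
    then have "\<forall>t\<in>UNIV. - d $ t = 0"
      using sum_d by (subst sum_nonneg_eq_0_iff[symmetric]) (auto simp: sum_negf)
    then show False using assms by (auto simp: vec_eq_iff y_eq)
  qed
  then have "0 < (\<Sum>t\<in>T. real CARD('n) * d $ t)"
    by (intro sum_pos) (auto simp: cut_times_eq)
  then show ?thesis by (simp add: sum_spread sum_subtractf agg_load_def)
qed

end

theorem theorem3p3:
  fixes E :: "'n::finite \<Rightarrow> real"
    and lo up :: "real^'t::finite^'n"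
    and P :: "(real^'t) set"
    and p :: "real^'t"
    and x y :: "nat \<Rightarrow> real^'t^'n"
  assumes "\<And>n. E n > 0"
    and "\<And>n. agent_set (E n) (lo $ n) (up $ n) \<noteq> {}"
    and "\<And>q. q \<in> P \<Longrightarrow> aggregate_ok E lo up q"
    and "p \<in> P"
    and "apm_iterates (profile_set E lo up) (disagg_set p) x y"
  shows "(profile_set E lo up \<inter> disagg_set p \<noteq> {} \<longrightarrow>
           (\<exists>xinf \<in> profile_set E lo up \<inter> disagg_set p.
              x \<longlonglongrightarrow> xinf \<and> y \<longlonglongrightarrow> xinf))
       \<and> (profile_set E lo up \<inter> disagg_set p = {} \<longrightarrow>
           (\<exists>xinf \<in> profile_set E lo up. \<exists>yinf \<in> disagg_set p.
              x \<longlonglongrightarrow> xinf \<and> y \<longlonglongrightarrow> yinf \<and>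
              (let T = cut_times up yinf; N = cut_agents E lo up T in
                 (\<Sum>n\<in>N. E n) - (\<Sum>t\<in>T. p $ t) + (\<Sum>t\<in>T. \<Sum>n\<in>-N. up $ n $ t)
                   - (\<Sum>t\<in>-T. \<Sum>n\<in>N. lo $ n $ t) < 0
                 \<and> \<not> hoffman_ineq E lo up p T N
                 \<and> agg_load T xinf < (\<Sum>t\<in>T. p $ t)
                 \<and> (\<Sum>n\<in>N. E n) + (\<Sum>t\<in>T. \<Sum>n\<in>-N. up $ n $ t)
                     - (\<Sum>t\<in>-T. \<Sum>n\<in>N. lo $ n $ t) = agg_load T xinf)))"
proof -
  let ?X = "profile_set E lo up" and ?Y = "disagg_set p :: (real^'t^'n) set"
  have X: "?X \<noteq> {}" using assms(2) by (rule profile_set_nonempty)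
  have Y: "?Y \<noteq> {}" using add_spread_in_disagg_set by blast
  obtain xinf yinf where lim: "x \<longlonglongrightarrow> xinf" "y \<longlonglongrightarrow> yinf"
    and xinf: "xinf = closest_point ?X yinf" and yinf: "yinf = closest_point ?Y xinf"
    by (rule apm_converges[OF compact_profile_set convex_profile_set X
          closed_disagg_set convex_disagg_set Y assms(5)])
  have xX: "xinf \<in> ?X"
    unfolding xinf by (rule closest_point_in_set[OF closed_profile_set X])
  have yY: "yinf \<in> ?Y"
    unfolding yinf by (rule closest_point_in_set[OF closed_disagg_set Y])
  show ?thesis
  proof (intro conjI impI)
    assume "?X \<inter> ?Y \<noteq> {}"
    then have "xinf = yinf"
      using closest_point_mutual_eq[OF convex_profile_set closed_profile_set
          convex_disagg_set closed_disagg_set xinf yinf] by blast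
    then show "\<exists>xinf \<in> ?X \<inter> ?Y. x \<longlonglongrightarrow> xinf \<and> y \<longlonglongrightarrow> xinf"
      using lim xX yY by auto
  next
    assume "?X \<inter> ?Y = {}"
    \<comment> \<open>A common limit would lie in both sets.\<close>
    then have ne: "xinf \<noteq> yinf" using xX yY by blast
    interpret apm_limit E lo up xinf yinf p
      by unfold_locales (fact assms(3)[OF assms(4)] xX xinf yinf)+
    \<comment> \<open>By \<open>agg_load_eq\<close>, the slack of the Hoffman inequality is the load
      of \<open>xinf\<close> over \<open>T\<close> minus the demand there, which is
      negative.\<close>
    have "\<not> hoffman_ineq E lo up p T N"
      using agg_load_eq agg_load_less[OF ne] unfolding hoffman_ineq_def by linarith
    moreover have "(\<Sum>n\<in>N. E n) - (\<Sum>t\<in>T. p $ t) + (\<Sum>t\<in>T. \<Sum>n\<in>-N. up $ n $ t)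
        - (\<Sum>t\<in>-T. \<Sum>n\<in>N. lo $ n $ t) < 0"
      using agg_load_eq agg_load_less[OF ne] by linarith
    ultimately show "\<exists>xinf \<in> ?X. \<exists>yinf \<in> ?Y. x \<longlonglongrightarrow> xinf \<and> y \<longlonglongrightarrow> yinf \<and>
              (let T = cut_times up yinf; N = cut_agents E lo up T in
                 (\<Sum>n\<in>N. E n) - (\<Sum>t\<in>T. p $ t) + (\<Sum>t\<in>T. \<Sum>n\<in>-N. up $ n $ t)
                   - (\<Sum>t\<in>-T. \<Sum>n\<in>N. lo $ n $ t) < 0
                 \<and> \<not> hoffman_ineq E lo up p T N
                 \<and> agg_load T xinf < (\<Sum>t\<in>T. p $ t)
                 \<and> (\<Sum>n\<in>N. E n) + (\<Sum>t\<in>T. \<Sum>n\<in>-N. up $ n $ t)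
                     - (\<Sum>t\<in>-T. \<Sum>n\<in>N. lo $ n $ t) = agg_load T xinf)"
      unfolding Let_def
      by (intro bexI[OF _ xX] bexI[OF _ yY] conjI lim agg_load_eq agg_load_less[OF ne])
  qed
qed

end
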